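(* Let $n\ge2$, let $q$ be a prime power and $\mathbb{V}_0=\mathbb{F}_q^n$. For the graph $\mathbf{SIG}(\mathbb{V}_0)$ the following statements hold: (1) There is no nontrivial twin class in the part $\mathbb{P}^{n-1}(\mathbb{F}_q)$. (2) In the part $\mathcal{E}^{n-1}(\mathbb{F}_q)$ there exists a positive integer $r$ such that $$\mathcal{E}^{n-1}(\mathbb{F}_q)=\{\langle I_n\rangle\}\cup\mathcal{C}_2\cup\cdots\cup\mathcal{C}_r$$ is the partition of the part $\mathcal{E}^{n-1}(\mathbb{F}_q)$ into twin classes, where every $\mathcal{C}_i$ is a nontrivial twin class.
   Context: $\mathbb{F}_q$ is the finite field with $q$ elements and $\mathbb{V}_0=\mathbb{F}_q^n$ is the space of column vectors. $E_n(\mathbb{F}_q)$ is the set of nonzero matrices $M\in M_n(\mathbb{F}_q)$ having at least one eigenvector in $\mathbb{V}_0$ (a nonzero $v$ with $Mv=\lambda v$ for some $\lambda\in\mathbb{F}_q$; $\lambda=0$ allowed). $\mathcal{E}^{n-1}(\mathbb{F}_q)=\{\langle M\rangle: M\in E_n(\mathbb{F}_q)\}$ is the set of one-dimensional subspaces of $M_n(\mathbb{F}_q)$ generated by elements of $E_n(\mathbb{F}_q)$, and $\mathbb{P}^{n-1}(\mathbb{F}_q)$ is the set of one-dimensional subspaces $\langle v\rangle$ of $\mathbb{V}_0$. The spectral incidence graph $\mathbf{SIG}(\mathbb{V}_0)$ is the simple bipartite graph with vertex set the disjoint union $\mathcal{E}^{n-1}(\mathbb{F}_q)\cup\mathbb{P}^{n-1}(\mathbb{F}_q)$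 in which $\langle M\rangle$ and $\langle v\rangle$ are adjacent iff $v$ is an eigenvector of $M$. The twin class of a vertex $x$ is $t(x)=\{y: N(y)=N(x)\}$, where $N(\cdot)$ denotes the set of neighbours; it is nontrivial if $t(x)\ne\{x\}$. *)

theory Defs
  imports
    "Jordan_Normal_Form.Char_Poly"
    "Jordan_Normal_Form.VS_Connect"
    "Graph_Theory.Pair_Digraph"
    "HOL-Library.Disjoint_Sets"
begin

text \<open>
  The field of \<open>q\<close> elements is a type \<open>'a\<close> of the classes \<open>field\<close> and \<open>finite\<close>, with
  \<open>q = CARD('a)\<close>, which is then automatically a prime power. Column vectors and square matrices of
  size \<open>n\<close> are the elements of \<open>carrier_vec n\<close> and \<open>carrier_mat n n\<close>.
\<close>

subsection \<open>Twin classes\<close>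

text \<open>Simple graphs are represented by symmetric loop-free digraphs, as in the locale \<open>pair_graph\<close>.\<close>

definition neighbours :: "'v pair_pre_digraph \<Rightarrow> 'v \<Rightarrow> 'v set" where
  "neighbours G x = {y. (x, y) \<in> parcs G}"

definition twin_class :: "'v pair_pre_digraph \<Rightarrow> 'v \<Rightarrow> 'v set" where
  "twin_class G x = {y \<in> pverts G. neighbours G y = neighbours G x}"

subsection \<open>The spectral incidence graph\<close>

definition vec_line :: "nat \<Rightarrow> 'a :: field vec \<Rightarrow> 'a vec set" where
  "vec_line n v = LinearCombinations.module.span class_ring (module_vec TYPE('a) n) {v}"

definition mat_line :: "nat \<Rightarrow> 'a :: field mat \<Rightarrow> 'a mat set" where
  "mat_line n M = LinearCombinations.module.span class_ring (module_mat TYPE('a) n n) {M}"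

definition eigen_mats :: "nat \<Rightarrow> 'a :: field mat set" where
  "eigen_mats n = {M \<in> carrier_mat n n. M \<noteq> 0\<^sub>m n n \<and> (\<exists>v k. eigenvector M v k)}"

definition eigen_lines :: "nat \<Rightarrow> 'a :: field mat set set" where
  "eigen_lines n = mat_line n ` eigen_mats n"

definition proj_points :: "nat \<Rightarrow> 'a :: field vec set set" where
  "proj_points n = vec_line n ` {v \<in> carrier_vec n. v \<noteq> 0\<^sub>v n}"

type_synonym 'a sig_vertex = "'a mat set + 'a vec set"

definition mat_part :: "nat \<Rightarrow> 'a :: field sig_vertex set" where
  "mat_part n = Inl ` eigen_lines n"

definition point_part :: "nat \<Rightarrow> 'a :: field sig_vertex set" where
  "point_part n = Inr ` proj_points n"

definition sig_incidence :: "nat \<Rightarrow> 'a :: field sig_vertex rel" where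
  "sig_incidence n =
     {(Inl (mat_line n M), Inr (vec_line n v)) | M v. M \<in> eigen_mats n \<and> (\<exists>k. eigenvector M v k)}"

definition SIG :: "nat \<Rightarrow> 'a :: field sig_vertex pair_pre_digraph" where
  "SIG n = \<lparr> pverts = mat_part n \<union> point_part n,
             parcs = sig_incidence n \<union> (sig_incidence n)\<inverse> \<rparr>"

subsection \<open>Well-definedness\<close>

lemma span_singleton:
  assumes "Module.module R M" and x: "x \<in> carrier M"
  shows "LinearCombinations.module.span R M {x} = {c \<odot>\<^bsub>M\<^esub> x | c. c \<in> carrier R}"
proof -
  interpret Module.module R M by fact
  have lc: "lincomb a {x} = a x \<odot>\<^bsub>M\<^esub> x" if "a x \<in> carrier R" for a
    using finsum_insert[of "{}" x "\<lambda>v. a v \<odot>\<^bsub>M\<^esub> v"] that x by (simp add: lincomb_def)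
  have "span {x} = {lincomb a {x} | a. a \<in> {x} \<rightarrow> carrier R}"
    using x by (intro finite_span) auto
  also have "\<dots> = {c \<odot>\<^bsub>M\<^esub> x | c. c \<in> carrier R}"
  proof (intro Set.set_eqI iffI)
    fix y assume "y \<in> {lincomb a {x} | a. a \<in> {x} \<rightarrow> carrier R}"
    then show "y \<in> {c \<odot>\<^bsub>M\<^esub> x | c. c \<in> carrier R}" using lc by auto
  next
    fix y assume "y \<in> {c \<odot>\<^bsub>M\<^esub> x | c. c \<in> carrier R}"
    then obtain c where "c \<in> carrier R" "y = c \<odot>\<^bsub>M\<^esub> x" by auto
    then show "y \<in> {lincomb a {x} | a. a \<in> {x} \<rightarrow> carrier R}"
      using lc[of "\<lambda>_. c"] by (auto intro!: exI[of _ "\<lambda>_. c"])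
  qed
  finally show ?thesis .
qed

lemma vec_line_eq:
  fixes v :: "'a :: field vec"
  assumes "v \<in> carrier_vec n"
  shows "vec_line n v = {c \<cdot>\<^sub>v v | c. True}"
  using span_singleton[OF vec_module, of v n] assms
  by (simp add: vec_line_def module_vec_simps class_ring_simps)

lemma mat_line_eq:
  fixes M :: "'a :: field mat"
  assumes "M \<in> carrier_mat n n"
  shows "mat_line n M = {c \<cdot>\<^sub>m M | c. True}"
proof -
  have "Module.module class_ring (module_mat TYPE('a) n n)"
    using matrix_vs unfolding vectorspace_def by blast
  from span_singleton[OF this, of M] assms show ?thesis
    by (simp add: mat_line_def module_mat_simps class_ring_simps)
qed

lemma vec_line_cong:
  fixes v w :: "'a :: field vec"
  assumes "v \<in> carrier_vec n" "w \<in> carrier_vec n" "w \<noteq> 0\<^sub>v n" "vec_line n v = vec_line n w"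
  obtains c where "c \<noteq> 0" "w = c \<cdot>\<^sub>v v"
proof -
  have "w \<in> vec_line n w" using assms(2) by (auto simp: vec_line_eq intro: exI[of _ 1])
  then obtain c where "w = c \<cdot>\<^sub>v v" using assms by (auto simp: vec_line_eq)
  moreover from this have "c \<noteq> 0" using assms by auto
  ultimately show ?thesis using that by blast
qed

lemma mat_line_cong:
  fixes M N :: "'a :: field mat"
  assumes "M \<in> carrier_mat n n" "N \<in> carrier_mat n n" "mat_line n M = mat_line n N"
  obtains c where "N = c \<cdot>\<^sub>m M"
proof -
  have "N = 1 \<cdot>\<^sub>m N" by auto
  then have "N \<in> mat_line n N" using assms(2) by (auto simp: mat_line_eq)
  then show ?thesis using assms that by (auto simp: mat_line_eq)
qed

lemma SIG_adjacent_iff: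
  fixes M :: "'a :: field mat"
  assumes M: "M \<in> eigen_mats n" and v: "v \<in> carrier_vec n" "v \<noteq> 0\<^sub>v n"
  shows "(Inl (mat_line n M), Inr (vec_line n v)) \<in> parcs (SIG n) \<longleftrightarrow> (\<exists>k. eigenvector M v k)"
proof
  assume "\<exists>k. eigenvector M v k"
  with M show "(Inl (mat_line n M), Inr (vec_line n v)) \<in> parcs (SIG n)"
    by (auto simp: SIG_def sig_incidence_def)
next
  assume "(Inl (mat_line n M), Inr (vec_line n v)) \<in> parcs (SIG n)"
  then obtain N w k where N: "N \<in> eigen_mats n" "eigenvector N w k"
    and eq: "mat_line n N = mat_line n M" "vec_line n w = vec_line n v"
    by (auto simp: SIG_def sig_incidence_def)
  have Nc: "N \<in> carrier_mat n n" and Mc: "M \<in> carrier_mat n n" using N M by (auto simp: eigen_mats_def)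
  have w: "w \<in> carrier_vec n" "N *\<^sub>v w = k \<cdot>\<^sub>v w" using N(2) Nc by (auto simp: eigenvector_def)
  obtain c where c: "M = c \<cdot>\<^sub>m N" using mat_line_cong[OF Nc Mc eq(1)] by blast
  obtain d where d: "v = d \<cdot>\<^sub>v w" using vec_line_cong[OF w(1) v eq(2)] by blast
  have "(c \<cdot>\<^sub>m N) *\<^sub>v v = c \<cdot>\<^sub>v (N *\<^sub>v v)"
    using Nc v by (intro eq_vecI) (auto simp: row_smult)
  then have "M *\<^sub>v v = (c * d * k) \<cdot>\<^sub>v w"
    using c d w by (simp add: mult_mat_vec[OF Nc] smult_smult_assoc mult.assoc)
  also have "\<dots> = (c * k) \<cdot>\<^sub>v v" using d by (simp add: smult_smult_assoc mult_ac)
  finally show "\<exists>k. eigenvector M v k" using v Mc by (auto simp: eigenvector_def)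
qed

lemma finite_carrier_vec: "finite (carrier_vec n :: 'a :: finite vec set)"
proof (rule finite_subset)
  show "carrier_vec n \<subseteq> vec_of_list ` {xs :: 'a list. set xs \<subseteq> UNIV \<and> length xs = n}"
  proof
    fix v :: "'a vec" assume "v \<in> carrier_vec n"
    then show "v \<in> vec_of_list ` {xs :: 'a list. set xs \<subseteq> UNIV \<and> length xs = n}"
      by (intro image_eqI[of _ _ "list_of_vec v"]) (auto simp: vec_list)
  qed
qed (intro finite_imageI finite_lists_length_eq, simp)

lemma finite_carrier_mat: "finite (carrier_mat m n :: 'a :: finite mat set)"
proof (rule finite_subset)
  show "carrier_mat m n \<subseteq>
          mat_of_rows n ` {xs :: 'a vec list. set xs \<subseteq> carrier_vec n \<and> length xs = m}"
  proof
    fix A :: "'a mat" assume "A \<in> carrier_mat m n"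
    then have "mat_of_rows n (rows A) = A" "set (rows A) \<subseteq> carrier_vec n" "length (rows A) = m"
      using mat_of_rows_rows[of A] rows_carrier[of A] by auto
    then show "A \<in> mat_of_rows n ` {xs. set xs \<subseteq> carrier_vec n \<and> length xs = m}"
      by (intro image_eqI[of _ _ "rows A"]) auto
  qed
qed (intro finite_imageI finite_lists_length_eq finite_carrier_vec)

lemma pair_graph_SIG: "pair_graph (SIG n :: 'a :: {field, finite} sig_vertex pair_pre_digraph)"
proof -
  let ?G = "SIG n :: 'a sig_vertex pair_pre_digraph"
  have sub: "parcs ?G \<subseteq> pverts ?G \<times> pverts ?G"
    by (auto simp: SIG_def sig_incidence_def mat_part_def point_part_def eigen_lines_def
        proj_points_def eigen_mats_def eigenvector_def)
  have fin: "finite (pverts ?G)"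
    unfolding SIG_def mat_part_def point_part_def eigen_lines_def proj_points_def
    by (auto intro!: finite_imageI intro: finite_subset[OF _ finite_carrier_mat[of n n]]
        finite_subset[OF _ finite_carrier_vec[of n]] simp: eigen_mats_def)
  show ?thesis
  proof unfold_locales
    show "finite (parcs ?G)" using sub fin finite_subset by blast
    show "symmetric (with_proj ?G)"
      by (auto simp: symmetric_def SIG_def intro!: symI)
    show "fst e \<noteq> snd e" if "e \<in> parcs ?G" for e
      using that by (auto simp: SIG_def sig_incidence_def)
  qed (use sub fin in auto)
qed

end

theory Submission
  imports Defs
begin

text \<open>
  Two vertices \<open>\<langle>M\<rangle>\<close> and \<open>\<langle>N\<rangle>\<close> are twins iff \<open>M\<close> and \<open>N\<close> have the same eigenvectors, since a
  point \<open>\<langle>v\<rangle>\<close> is adjacent to \<open>\<langle>M\<rangle>\<close> exactly if \<open>v\<close> is an eigenvector of \<open>M\<close>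
  (\<open>neighbours_mat_eq_iff\<close>). Adding \<open>I\<close> to a matrix shifts its eigenvalues and keeps its
  eigenvectors. If \<open>M\<close> is not scalar, then \<open>M + I\<close> is nonzero and not a multiple of \<open>M\<close>, so
  \<open>\<langle>M + I\<rangle>\<close> is a twin of \<open>\<langle>M\<rangle>\<close> distinct from it (\<open>twin_class_nonscalar\<close>).
  On the other hand, every nonzero vector is an eigenvector of \<open>I\<close>, and
  only scalar matrices have this property (\<open>scalar_if_all_eigenvectors\<close>), so \<open>\<langle>I\<rangle>\<close> is alone in its
  class.

  Two distinct points \<open>\<langle>v\<rangle>\<close> and \<open>\<langle>w\<rangle>\<close> are told apart by the rank-one matrix \<open>v e\<^sub>l\<^sup>T\<close>, where
  \<open>w\<^sub>l \<noteq> 0\<close>: it has \<open>v\<close> as an eigenvector and maps \<open>w\<close> to the nonzero multiple \<open>w\<^sub>l v\<close> of \<open>v\<close>, which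
  is not a multiple of \<open>w\<close> (\<open>separating_eigen_mat\<close>).

  A vertex of one part is never a twin of a vertex of the other part, because every \<open>\<langle>M\<rangle>\<close> has a
  neighbour, which is a point, while no two points are adjacent;
  hence twin classes can be studied in each part separately.
\<close>

section \<open>Eigenvectors\<close>

lemma one_mat_in_eigen_mats:
  assumes "n \<ge> 1"
  shows "1\<^sub>m n \<in> (eigen_mats n :: 'a :: field mat set)"
proof -
  have "(1\<^sub>m n :: 'a mat) \<noteq> 0\<^sub>m n n"
  proof
    assume "(1\<^sub>m n :: 'a mat) = 0\<^sub>m n n"
    from arg_cong[OF this, of "\<lambda>A. A $$ (0, 0)"] assms show False by simp
  qed
  moreover have "eigenvector (1\<^sub>m n) (unit_vec n 0) (1 :: 'a)"
    using assms by (auto simp: eigenvector_def)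
  ultimately show ?thesis unfolding eigen_mats_def by auto
qed

lemma eigenvector_add_one_mat:
  fixes M :: "'a :: field mat"
  assumes M: "M \<in> carrier_mat n n"
  shows "(\<exists>k. eigenvector (M + 1\<^sub>m n) v k) \<longleftrightarrow> (\<exists>k. eigenvector M v k)"
proof (cases "v \<in> carrier_vec n")
  case v: True
  have "(M + 1\<^sub>m n) *\<^sub>v v = M *\<^sub>v v + v"
    using add_mult_distrib_mat_vec[OF M one_carrier_mat v] v by simp
  moreover have "M *\<^sub>v v + v = (k + 1) \<cdot>\<^sub>v v \<longleftrightarrow> M *\<^sub>v v = k \<cdot>\<^sub>v v" for k
    using M v by (auto simp: vec_eq_iff algebra_simps)
  ultimately have "eigenvector (M + 1\<^sub>m n) v (k + 1) \<longleftrightarrow> eigenvector M v k" for k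
    using M v by (simp add: eigenvector_def)
  then show ?thesis by (metis diff_add_cancel)
qed (use M in \<open>auto simp: eigenvector_def\<close>)

text \<open>
  The unit vectors being eigenvectors makes the matrix diagonal, and the vectors
  \<open>e\<^sub>i + e\<^sub>0\<close> being eigenvectors forces equal diagonal entries.
\<close>

lemma scalar_if_all_eigenvectors:
  fixes M :: "'a :: field mat"
  assumes M: "M \<in> carrier_mat n n" and n: "n \<ge> 1"
    and all: "\<And>v. v \<in> carrier_vec n \<Longrightarrow> v \<noteq> 0\<^sub>v n \<Longrightarrow> \<exists>k. eigenvector M v k"
  shows "M = (M $$ (0, 0)) \<cdot>\<^sub>m 1\<^sub>m n"
proof -
  have unit: "(M *\<^sub>v unit_vec n i) $ j = M $$ (j, i)" if "i < n" "j < n" for i j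
    using that M by (simp add: scalar_prod_right_unit)
  have off: "M $$ (j, i) = 0" if ij: "i < n" "j < n" "i \<noteq> j" for i j
  proof -
    obtain k where "eigenvector M (unit_vec n i) k"
      using all[of "unit_vec n i"] ij by auto
    then have "M *\<^sub>v unit_vec n i = k \<cdot>\<^sub>v unit_vec n i" by (simp add: eigenvector_def)
    from arg_cong[OF this, of "\<lambda>v. v $ j"] unit[OF ij(1,2)] ij show ?thesis by simp
  qed
  have diag: "M $$ (i, i) = M $$ (0, 0)" if i: "i < n" "i \<noteq> 0" for i
  proof -
    let ?v = "unit_vec n i + unit_vec n 0 :: 'a vec"
    have "?v \<noteq> 0\<^sub>v n"
    proof
      assume "?v = 0\<^sub>v n"
      from arg_cong[OF this, of "\<lambda>v. v $ i"] i show False by simp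
    qed
    then obtain k where "eigenvector M ?v k" using all[of ?v] by auto
    then have "M *\<^sub>v ?v = k \<cdot>\<^sub>v ?v" by (simp add: eigenvector_def)
    moreover have "M *\<^sub>v ?v = M *\<^sub>v unit_vec n i + M *\<^sub>v unit_vec n 0"
      by (rule mult_add_distrib_mat_vec[OF M]) auto
    ultimately have eq: "M *\<^sub>v unit_vec n i + M *\<^sub>v unit_vec n 0 = k \<cdot>\<^sub>v ?v" by simp
    have entry: "M $$ (j, i) + M $$ (j, 0) = k * ?v $ j" if "j < n" for j
      using arg_cong[OF eq, of "\<lambda>v. v $ j"] that i M unit[of i j] unit[of 0 j] by simp
    show ?thesis using entry[of i] entry[of 0] off[of i 0] off[of 0 i] i by simp
  qed
  show ?thesis
  proof (rule eq_matI)
    fix i j assume "i < dim_row (M $$ (0, 0) \<cdot>\<^sub>m 1\<^sub>m n)" "j < dim_col (M $$ (0, 0) \<cdot>\<^sub>m 1\<^sub>m n)"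
    then have ij: "i < n" "j < n" by simp_all
    show "M $$ (i, j) = (M $$ (0, 0) \<cdot>\<^sub>m 1\<^sub>m n) $$ (i, j)"
      using ij off[of j i] diag[of i] by (cases "i = j"; cases "i = 0") simp_all
  qed (use M in auto)
qed

text \<open>
  The witness is \<open>v e\<^sub>l\<^sup>T\<close> for an index \<open>l\<close> with \<open>w\<^sub>l \<noteq> 0\<close>. Its range is the line of \<open>v\<close>, so \<open>v\<close>
  is an eigenvector, and \<open>w\<close> could only be one if it were mapped to \<open>0\<close>.
\<close>

lemma separating_eigen_mat:
  fixes v w :: "'a :: field vec"
  assumes v: "v \<in> carrier_vec n" "v \<noteq> 0\<^sub>v n" and w: "w \<in> carrier_vec n" "w \<noteq> 0\<^sub>v n"
    and ne: "vec_line n v \<noteq> vec_line n w"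
  obtains M where "M \<in> eigen_mats n" "\<exists>k. eigenvector M v k" "\<nexists>k. eigenvector M w k"
proof -
  obtain l where l: "l < n" "w $ l \<noteq> 0" using w by (auto simp: vec_eq_iff)
  define M where "M = mat n n (\<lambda>(i, j). if j = l then v $ i else 0)"
  have M: "M \<in> carrier_mat n n" by (simp add: M_def)
  have app: "M *\<^sub>v x = (x $ l) \<cdot>\<^sub>v v" if x: "x \<in> carrier_vec n" for x
  proof (rule eq_vecI)
    fix i assume "i < dim_vec ((x $ l) \<cdot>\<^sub>v v)"
    then have i: "i < n" using v by simp
    have "(M *\<^sub>v x) $ i = (\<Sum>j = 0..<n. (if j = l then v $ i else 0) * x $ j)"
      using i x by (auto simp: M_def scalar_prod_def)
    also have "\<dots> = (\<Sum>j = 0..<n. if j = l then v $ i * x $ l else 0)"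
      by (intro sum.cong) auto
    also have "\<dots> = v $ i * x $ l" using l by simp
    finally show "(M *\<^sub>v x) $ i = ((x $ l) \<cdot>\<^sub>v v) $ i" using i v by simp
  qed (use v M in auto)
  have ev: "eigenvector M v (v $ l)" using M v app[OF v(1)] by (simp add: eigenvector_def)
  have not_multiple: "v \<noteq> c \<cdot>\<^sub>v w" for c
  proof
    assume eq: "v = c \<cdot>\<^sub>v w"
    then have "c \<noteq> 0" using v w by auto
    then have "a \<cdot>\<^sub>v w = (a / c) \<cdot>\<^sub>v v" for a by (simp add: eq smult_smult_assoc)
    then have "vec_line n v = vec_line n w"
      using v w by (auto simp: vec_line_eq) (metis eq smult_smult_assoc)+
    with ne show False ..
  qed
  have nw: "\<nexists>k. eigenvector M w k"
  proof
    assume "\<exists>k. eigenvector M w k"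
    then obtain k where "(w $ l) \<cdot>\<^sub>v v = k \<cdot>\<^sub>v w" using app[OF w(1)] by (auto simp: eigenvector_def)
    then have "inverse (w $ l) \<cdot>\<^sub>v ((w $ l) \<cdot>\<^sub>v v) = inverse (w $ l) \<cdot>\<^sub>v (k \<cdot>\<^sub>v w)" by simp
    then have "v = (inverse (w $ l) * k) \<cdot>\<^sub>v w" using l by (simp add: smult_smult_assoc)
    with not_multiple show False by blast
  qed
  have "M \<noteq> 0\<^sub>m n n"
  proof
    assume "M = 0\<^sub>m n n"
    then have "eigenvector M w 0" using w by (auto simp: eigenvector_def)
    with nw show False by blast
  qed
  with M ev have "M \<in> eigen_mats n" by (auto simp: eigen_mats_def)
  with ev nw show ?thesis using that by blast
qed

section \<open>Neighbours in the spectral incidence graph\<close>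

lemma mem_neighbours_mat_iff:
  assumes "M \<in> eigen_mats n" "v \<in> carrier_vec n" "v \<noteq> 0\<^sub>v n"
  shows "Inr (vec_line n v) \<in> neighbours (SIG n) (Inl (mat_line n M)) \<longleftrightarrow> (\<exists>k. eigenvector M v k)"
  using SIG_adjacent_iff[OF assms] by (simp add: neighbours_def)

lemma mem_neighbours_point_iff:
  assumes "M \<in> eigen_mats n" "v \<in> carrier_vec n" "v \<noteq> 0\<^sub>v n"
  shows "Inl (mat_line n M) \<in> neighbours (SIG n) (Inr (vec_line n v)) \<longleftrightarrow> (\<exists>k. eigenvector M v k)"
proof -
  have "(Inr a, Inl b) \<in> parcs (SIG n) \<longleftrightarrow> (Inl b, Inr a) \<in> parcs (SIG n)"
    for a :: "'a vec set" and b
    by (auto simp: SIG_def sig_incidence_def)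
  then show ?thesis using SIG_adjacent_iff[OF assms] by (simp add: neighbours_def)
qed

lemma neighbours_mat_subset: "neighbours (SIG n) (Inl L) \<subseteq> point_part n"
  by (auto simp: neighbours_def SIG_def sig_incidence_def point_part_def proj_points_def
      eigen_mats_def eigenvector_def)

lemma neighbours_mat_eq_iff:
  assumes "M \<in> eigen_mats n" "N \<in> eigen_mats n"
  shows "neighbours (SIG n) (Inl (mat_line n M)) = neighbours (SIG n) (Inl (mat_line n N)) \<longleftrightarrow>
    (\<forall>v \<in> carrier_vec n. v \<noteq> 0\<^sub>v n \<longrightarrow> (\<exists>k. eigenvector M v k) = (\<exists>k. eigenvector N v k))"
    (is "?A = ?B \<longleftrightarrow> ?same")
proof
  assume "?A = ?B"
  then show ?same using assms by (metis mem_neighbours_mat_iff)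
next
  assume same: ?same
  have "y \<in> ?A \<longleftrightarrow> y \<in> ?B" if y: "y \<in> point_part n" for y
    using y same mem_neighbours_mat_iff[OF assms(1)] mem_neighbours_mat_iff[OF assms(2)]
    by (auto simp: point_part_def proj_points_def)
  then show "?A = ?B" using neighbours_mat_subset by blast
qed

text \<open>An eigenvector of the matrix spans a point adjacent to \<open>x\<close>, but points are never adjacent.\<close>

lemma neighbours_mat_neq_point:
  assumes "x \<in> mat_part n"
  shows "neighbours (SIG n) x \<noteq> neighbours (SIG n) (Inr p)"
proof -
  obtain M v k where x: "x = Inl (mat_line n M)" and M: "M \<in> eigen_mats n" "eigenvector M v k"
    using assms unfolding mat_part_def eigen_lines_def eigen_mats_def by blast
  then have "Inr (vec_line n v) \<in> neighbours (SIG n) x"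
    by (auto simp: neighbours_def SIG_def sig_incidence_def)
  moreover have "Inr (vec_line n v) \<notin> neighbours (SIG n) (Inr p)"
    by (auto simp: neighbours_def SIG_def sig_incidence_def)
  ultimately show ?thesis by metis
qed

section \<open>Twin classes\<close>

lemma twin_class_point:
  assumes x: "x \<in> point_part n"
  shows "twin_class (SIG n) x = {x}"
proof
  show "{x} \<subseteq> twin_class (SIG n) x" using x by (auto simp: twin_class_def SIG_def)
  obtain v where v: "v \<in> carrier_vec n" "v \<noteq> 0\<^sub>v n" "x = Inr (vec_line n v)"
    using x by (auto simp: point_part_def proj_points_def)
  show "twin_class (SIG n) x \<subseteq> {x}"
  proof
    fix y assume "y \<in> twin_class (SIG n) x"
    then have yV: "y \<in> mat_part n \<union> point_part n"
      and eq: "neighbours (SIG n) y = neighbours (SIG n) x"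
      by (auto simp: twin_class_def SIG_def)
    then have "y \<in> point_part n" using neighbours_mat_neq_point[of y n] v(3) by auto
    then obtain w where w: "w \<in> carrier_vec n" "w \<noteq> 0\<^sub>v n" "y = Inr (vec_line n w)"
      by (auto simp: point_part_def proj_points_def)
    show "y \<in> {x}"
    proof (rule ccontr)
      assume "y \<notin> {x}"
      then have "vec_line n v \<noteq> vec_line n w" using v w by auto
      then obtain M where "M \<in> eigen_mats n" "\<exists>k. eigenvector M v k" "\<nexists>k. eigenvector M w k"
        using separating_eigen_mat[OF v(1,2) w(1,2)] by blast
      with eq show False using v w by (metis mem_neighbours_point_iff)
    qed
  qed
qed

lemma twin_class_mat_part:
  assumes "x \<in> mat_part n"
  shows "twin_class (SIG n) x = {y \<in> mat_part n. neighbours (SIG n) y = neighbours (SIG n) x}"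
  using neighbours_mat_neq_point[OF assms]
  by (auto simp: twin_class_def SIG_def point_part_def)

lemma partition_on_twin_classes:
  "partition_on (mat_part n) (twin_class (SIG n) ` mat_part n)"
  by (rule partition_onI) (auto simp: twin_class_mat_part disjnt_def)

lemma mat_line_smult_one:
  fixes c :: "'a :: field"
  assumes "c \<noteq> 0"
  shows "mat_line n (c \<cdot>\<^sub>m 1\<^sub>m n) = mat_line n (1\<^sub>m n)"
proof -
  have smult: "a \<cdot>\<^sub>m (b \<cdot>\<^sub>m 1\<^sub>m n) = (a * b) \<cdot>\<^sub>m (1\<^sub>m n :: 'a mat)" for a b
    by (intro eq_matI) auto
  have "a \<cdot>\<^sub>m 1\<^sub>m n = (a / c) \<cdot>\<^sub>m (c \<cdot>\<^sub>m (1\<^sub>m n :: 'a mat))" for a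
    using assms by (simp add: smult)
  then have "range (\<lambda>a. a \<cdot>\<^sub>m (1\<^sub>m n :: 'a mat)) \<subseteq> range (\<lambda>a. a \<cdot>\<^sub>m (c \<cdot>\<^sub>m 1\<^sub>m n))" by blast
  moreover have "range (\<lambda>a. a \<cdot>\<^sub>m (c \<cdot>\<^sub>m 1\<^sub>m n)) \<subseteq> range (\<lambda>a. a \<cdot>\<^sub>m (1\<^sub>m n :: 'a mat))"
    by (auto simp: smult)
  ultimately show ?thesis by (simp add: mat_line_eq full_SetCompr_eq)
qed

lemma twin_class_one:
  assumes n: "n \<ge> 1"
  shows "twin_class (SIG n) (Inl (mat_line n (1\<^sub>m n))) = {Inl (mat_line n (1\<^sub>m n :: 'a :: field mat))}"
    (is "twin_class _ ?x = _")
proof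
  have x: "?x \<in> mat_part n"
    using one_mat_in_eigen_mats[OF n] by (auto simp: mat_part_def eigen_lines_def)
  then show "{?x} \<subseteq> twin_class (SIG n) ?x" by (simp add: twin_class_mat_part)
  show "twin_class (SIG n) ?x \<subseteq> {?x}"
  proof
    fix y assume "y \<in> twin_class (SIG n) ?x"
    with x obtain M where M: "M \<in> eigen_mats n" "y = Inl (mat_line n M)"
      and eq: "neighbours (SIG n) y = neighbours (SIG n) ?x"
      by (auto simp: twin_class_mat_part mat_part_def eigen_lines_def)
    have Mc: "M \<in> carrier_mat n n" "M \<noteq> 0\<^sub>m n n" using M by (auto simp: eigen_mats_def)
    have "eigenvector (1\<^sub>m n) v 1" if "v \<in> carrier_vec n" "v \<noteq> 0\<^sub>v n" for v :: "'a vec"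
      using that by (simp add: eigenvector_def)
    then have "\<exists>k. eigenvector M v k" if "v \<in> carrier_vec n" "v \<noteq> 0\<^sub>v n" for v
      using that eq M(2) neighbours_mat_eq_iff[OF M(1) one_mat_in_eigen_mats[OF n]] by blast
    then have scalar: "M = (M $$ (0, 0)) \<cdot>\<^sub>m 1\<^sub>m n" by (rule scalar_if_all_eigenvectors[OF Mc(1) n])
    have "M $$ (0, 0) \<noteq> 0"
    proof
      assume "M $$ (0, 0) = 0"
      with scalar have "M = 0 \<cdot>\<^sub>m 1\<^sub>m n" by simp
      also have "\<dots> = 0\<^sub>m n n" by (intro eq_matI) auto
      finally show False using Mc(2) by simp
    qed
    then have "mat_line n M = mat_line n (1\<^sub>m n)" using mat_line_smult_one scalar by metis
    then show "y \<in> {?x}" using M(2) by simp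
  qed
qed

text \<open>
  \<open>\<langle>M + I\<rangle>\<close> is a second member of the class: if \<open>M + I = c M\<close>, then \<open>(c - 1) M = I\<close>, so \<open>M\<close>
  would be scalar.
\<close>

lemma twin_class_nonscalar:
  fixes x :: "'a :: field sig_vertex"
  assumes x: "x \<in> mat_part n" and ne: "x \<noteq> Inl (mat_line n (1\<^sub>m n))"
  shows "twin_class (SIG n) x \<noteq> {x}"
proof -
  obtain M where M: "M \<in> eigen_mats n" "x = Inl (mat_line n M)"
    using x by (auto simp: mat_part_def eigen_lines_def)
  have Mc: "M \<in> carrier_mat n n" "M \<noteq> 0\<^sub>m n n" using M by (auto simp: eigen_mats_def)
  have nonscalar: "M \<noteq> c \<cdot>\<^sub>m 1\<^sub>m n" for c
  proof
    assume eq: "M = c \<cdot>\<^sub>m 1\<^sub>m n"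
    have "c \<noteq> 0"
    proof
      assume "c = 0"
      with eq have "M = 0\<^sub>m n n" by (auto intro!: eq_matI)
      with Mc show False by simp
    qed
    with eq ne M(2) show False using mat_line_smult_one by metis
  qed
  have multiple_neq: "M + 1\<^sub>m n \<noteq> c \<cdot>\<^sub>m M" for c
  proof
    assume eq: "M + 1\<^sub>m n = c \<cdot>\<^sub>m M"
    have entry: "(c - 1) * M $$ (i, j) = (1\<^sub>m n :: 'a mat) $$ (i, j)" if "i < n" "j < n" for i j
      using arg_cong[OF eq, of "\<lambda>A. A $$ (i, j)"] that Mc by (simp add: algebra_simps)
    show False
    proof (cases "c = 1")
      case True
      \<comment> \<open>Here \<open>I\<close> would be zero, so \<open>n = 0\<close> and there is no nonzero matrix.\<close>
      then have "n = 0" using entry[of 0 0] by (cases n) auto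
      then have "M = 0\<^sub>m n n" using Mc by auto
      with Mc show False by simp
    next
      case False
      then have "M = inverse (c - 1) \<cdot>\<^sub>m 1\<^sub>m n"
        using Mc entry by (intro eq_matI) (auto simp: field_simps simp del: index_one_mat(1))
      with nonscalar show False by blast
    qed
  qed
  let ?N = "M + 1\<^sub>m n"
  have "?N \<noteq> 0\<^sub>m n n"
  proof
    assume "?N = 0\<^sub>m n n"
    also have "0\<^sub>m n n = 0 \<cdot>\<^sub>m M" using Mc by (intro eq_matI) auto
    finally show False using multiple_neq by blast
  qed
  then have N: "?N \<in> eigen_mats n"
    using M Mc eigenvector_add_one_mat[OF Mc(1)] by (simp add: eigen_mats_def)
  have "mat_line n M \<noteq> mat_line n ?N"
    using mat_line_cong[of M n ?N] multiple_neq Mc by (metis add_carrier_mat one_carrier_mat)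
  moreover have "Inl (mat_line n ?N) \<in> twin_class (SIG n) x"
    using x N M neighbours_mat_eq_iff[OF N M(1)] eigenvector_add_one_mat[OF Mc(1)]
    by (auto simp: twin_class_mat_part mat_part_def eigen_lines_def)
  ultimately show ?thesis using M(2) by auto
qed

lemma finite_mat_part: "finite (mat_part n :: 'a :: {field, finite} sig_vertex set)"
  unfolding mat_part_def eigen_lines_def
  by (auto intro!: finite_imageI intro: finite_subset[OF _ finite_carrier_mat[of n n]]
      simp: eigen_mats_def)

theorem theorem2p8:
  fixes n :: nat and G :: "'a :: {field, finite} sig_vertex pair_pre_digraph"
  assumes "n \<ge> 2" and "G = SIG n"
  shows "\<not> (\<exists>x \<in> point_part n. twin_class G x \<noteq> {x}) \<and>
         (\<exists>r \<ge> 1. \<exists>C :: nat \<Rightarrow> 'a sig_vertex set.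
           C 1 = {Inl (mat_line n (1\<^sub>m n))} \<and>
           inj_on C {1..r} \<and>
           partition_on (mat_part n) (C ` {1..r}) \<and>
           (\<forall>i \<in> {1..r}. \<exists>x \<in> mat_part n. C i = twin_class G x) \<and>
           (\<forall>i \<in> {2..r}. \<exists>x \<in> mat_part n. C i = twin_class G x \<and> twin_class G x \<noteq> {x}))"
proof -
  let ?I = "Inl (mat_line n (1\<^sub>m n)) :: 'a sig_vertex"
  let ?T = "twin_class G ` mat_part n"
  have n: "n \<ge> 1" using assms by simp
  have I: "?I \<in> mat_part n" "twin_class G ?I = {?I}"
    using one_mat_in_eigen_mats[OF n] twin_class_one[OF n] assms(2)
    by (auto simp: mat_part_def eigen_lines_def)
  then have IT: "{?I} \<in> ?T" by (metis imageI)
  have "finite (?T - {{?I}})" using finite_mat_part by auto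
  then obtain h where h: "bij_betw h {1..card (?T - {{?I}})} (?T - {{?I}})"
    using ex_bij_betw_nat_finite_1 by blast
  define r where "r = Suc (card (?T - {{?I}}))"
  \<comment> \<open>The class of \<open>\<langle>I\<rangle>\<close> comes first, then the other classes in any order.\<close>
  define C where "C i = (if i = 1 then {?I} else h (i - 1))" for i
  have "bij_betw (\<lambda>i. i - 1) {2..r} {1..card (?T - {{?I}})}"
    by (rule bij_betw_byWitness[of _ Suc]) (auto simp: r_def)
  from bij_betw_trans[OF this h] have "bij_betw (\<lambda>i. h (i - 1)) {2..r} (?T - {{?I}})"
    by (simp add: comp_def)
  then have C2: "bij_betw C {2..r} (?T - {{?I}})"
    by (rule bij_betw_cong[THEN iffD1, rotated]) (auto simp: C_def)
  have "{1..r} = insert 1 {2..r}" by (auto simp: r_def)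
  moreover have "C 1 = {?I}" by (simp add: C_def)
  ultimately have C: "inj_on C {1..r}" "C ` {1..r} = ?T"
    using C2 IT by (auto simp: bij_betw_def)
  have "\<exists>x \<in> mat_part n. C i = twin_class G x \<and> twin_class G x \<noteq> {x}" if "i \<in> {2..r}" for i
  proof -
    have "C i \<in> ?T - {{?I}}" using C2 that by (rule bij_betw_apply)
    then obtain x where x: "x \<in> mat_part n" "C i = twin_class G x" "twin_class G x \<noteq> {?I}" by blast
    then have "x \<noteq> ?I" using I(2) by metis
    with x show ?thesis using twin_class_nonscalar assms(2) by metis
  qed
  moreover have "\<exists>x \<in> mat_part n. C i = twin_class G x" if "i \<in> {1..r}" for i
    using C(2) that by (metis imageE imageI)
  moreover have "partition_on (mat_part n) (C ` {1..r})"
    using C(2) partition_on_twin_classes assms(2) by metis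
  moreover have "r \<ge> 1" by (simp add: r_def)
  ultimately show ?thesis
    using C(1) \<open>C 1 = {?I}\<close> twin_class_point assms(2) by blast
qed

end
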